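(* If $Q$ is a balanced quiver, then $\mathrm{mut}_m(Q)$ is balanced for every vertex $m$ of $Q$. Thus the class of balanced quivers is closed under mutation.
   Context: All quivers have finitely many vertices and finitely many arrows between any two vertices. A decorated quiver is a quiver with no self-loops or $2$-cycles each of whose vertices $v$ carries a label $(w_v,\ell_v)\in\mathbb{Z}^2$; its underlying quiver is obtained by forgetting the labels. For vertices $x,y$, $\mathrm{a}(x,y)$ is the signed number of arrows between them: positive if arrows point from $x$ to $y$, negative if from $y$ to $x$, zero if there are none. $\mathrm{out}(m)$ is the set of vertices receiving an arrow from $m$, and $\mathrm{in}(m)$ is the set of vertices from which $m$ receives an arrow. A decorated quiver $Q$ is balanced if for every vertex $m$, $\sum_{h\in\mathrm{out}(m)}w_h\,\mathrm{a}(m,h)=\sum_{t\in\mathrm{in}(m)}w_t\,\mathrm{a}(t,m)$. The common value is called the diameter $D(m)$ of $m$. Mutation: let $Q$ be balanced and $m$ a vertex with label $(w,\ell)$. The underlying quiver of $\mathrm{mut}_m(Q)$ is the usual quiver mutation at $m$: for every path $t\to m\to h$ add an arrow $t\to h$; reverse all arrows incident at $m$; cancel all $2$-cycles. A vertex $v\ne m$ keeps its label, and $m$ receives the label $(D(m)-w,\,D(m)-\ell)$, where $D(m)$ is computed in $Q$. *)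

theory Defs
  imports Main
begin

text \<open>
  A quiver is given by its vertex set and the number of arrows between each ordered pair of
  vertices. Cancelling 2-cycles involves a choice of arrows, so with individually named arrows
  mutation would only be well-defined up to isomorphism; with multiplicities it is a function.
\<close>

record 'v quiver =
  verts :: "'v set"
  arrows :: "'v \<Rightarrow> 'v \<Rightarrow> nat"

record 'v decorated_quiver = "'v quiver" +
  labels :: "'v \<Rightarrow> int \<times> int"

definition is_quiver :: "('v, 'b) quiver_scheme \<Rightarrow> bool" where
  "is_quiver Q \<longleftrightarrow> finite (verts Q) \<and>
     (\<forall>x y. arrows Q x y > 0 \<longrightarrow> x \<in> verts Q \<and> y \<in> verts Q)"

definition is_decorated_quiver :: "'v decorated_quiver \<Rightarrow> bool" where
  "is_decorated_quiver Q \<longleftrightarrow> is_quiver Q \<and>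
     (\<forall>x. arrows Q x x = 0) \<and>
     (\<forall>x y. \<not> (arrows Q x y > 0 \<and> arrows Q y x > 0))"

definition wt :: "'v decorated_quiver \<Rightarrow> 'v \<Rightarrow> int" where
  "wt Q v = fst (labels Q v)"

definition len :: "'v decorated_quiver \<Rightarrow> 'v \<Rightarrow> int" where
  "len Q v = snd (labels Q v)"

definition signed_arrows :: "('v, 'b) quiver_scheme \<Rightarrow> 'v \<Rightarrow> 'v \<Rightarrow> int" where
  "signed_arrows Q x y =
     (if arrows Q x y > 0 then int (arrows Q x y) else - int (arrows Q y x))"

definition out_set :: "('v, 'b) quiver_scheme \<Rightarrow> 'v \<Rightarrow> 'v set" where
  "out_set Q m = {h \<in> verts Q. arrows Q m h > 0}"

definition in_set :: "('v, 'b) quiver_scheme \<Rightarrow> 'v \<Rightarrow> 'v set" where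
  "in_set Q m = {t \<in> verts Q. arrows Q t m > 0}"

definition balanced :: "'v decorated_quiver \<Rightarrow> bool" where
  "balanced Q \<longleftrightarrow> is_decorated_quiver Q \<and>
     (\<forall>m \<in> verts Q.
        (\<Sum>h \<in> out_set Q m. wt Q h * signed_arrows Q m h) =
        (\<Sum>t \<in> in_set Q m. wt Q t * signed_arrows Q t m))"

text \<open>
  The diameter is the common value of the two sums of a balanced quiver; it is written here as
  the sum over outgoing arrows, and is only meaningful if the quiver is balanced.
\<close>

definition diameter :: "'v decorated_quiver \<Rightarrow> 'v \<Rightarrow> int" where
  "diameter Q m = (\<Sum>h \<in> out_set Q m. wt Q h * signed_arrows Q m h)"

text \<open>There are \<open>a t m * a m h\<close> paths from \<open>t\<close> through \<open>m\<close> to \<open>h\<close>.\<close>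

definition add_composites :: "'v \<Rightarrow> ('v \<Rightarrow> 'v \<Rightarrow> nat) \<Rightarrow> ('v \<Rightarrow> 'v \<Rightarrow> nat)" where
  "add_composites m a = (\<lambda>t h. a t h + a t m * a m h)"

definition reverse_at :: "'v \<Rightarrow> ('v \<Rightarrow> 'v \<Rightarrow> nat) \<Rightarrow> ('v \<Rightarrow> 'v \<Rightarrow> nat)" where
  "reverse_at m a = (\<lambda>x y. if x = m \<or> y = m then a y x else a x y)"

text \<open>
  A maximal set of disjoint 2-cycles between \<open>x\<close> and \<open>y\<close> has \<open>min (a x y) (a y x)\<close> elements.
  Loops are not 2-cycles and are left alone.
\<close>

definition cancel_2_cycles :: "('v \<Rightarrow> 'v \<Rightarrow> nat) \<Rightarrow> ('v \<Rightarrow> 'v \<Rightarrow> nat)" where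
  "cancel_2_cycles a = (\<lambda>x y. if x = y then a x y else a x y - min (a x y) (a y x))"

definition quiver_mutation :: "'v \<Rightarrow> ('v, 'b) quiver_scheme \<Rightarrow> ('v, 'b) quiver_scheme" where
  "quiver_mutation m Q =
     Q\<lparr>arrows := cancel_2_cycles (reverse_at m (add_composites m (arrows Q)))\<rparr>"

definition mut :: "'v \<Rightarrow> 'v decorated_quiver \<Rightarrow> 'v decorated_quiver" where
  "mut m Q = (quiver_mutation m Q)
     \<lparr>labels := (labels Q)(m := (diameter Q m - wt Q m, diameter Q m - len Q m))\<rparr>"

end

theory Submission
  imports Defs
begin

text \<open>
  Balance at \<open>x\<close> says that \<open>\<Sum>y. w y * s x y = 0\<close>, where \<open>s\<close> is the skew-symmetric matrix of
  signed arrow numbers. Cancelling 2-cycles does not change this matrix, so mutation at \<open>m\<close>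
  negates row and column \<open>m\<close> and adds \<open>a x m * a m y - a y m * a m x\<close> to every other entry.
  At \<open>m\<close> the sum is therefore only negated. At \<open>x \<noteq> m\<close> the new arrows contribute
  \<open>D m * (a x m - a m x) = D m * s x m\<close>, and the term of \<open>m\<close> changes from \<open>w m * s x m\<close> to
  \<open>- (D m - w m) * s x m\<close>; the two changes cancel.
\<close>

lemma signed_arrows_eq_diff:
  assumes "is_decorated_quiver Q"
  shows "signed_arrows Q x y = int (arrows Q x y) - int (arrows Q y x)"
proof -
  have "arrows Q x y = 0 \<or> arrows Q y x = 0"
    using assms by (auto simp: is_decorated_quiver_def)
  then show ?thesis
    by (auto simp: signed_arrows_def)
qed

text \<open>The sets \<open>out_set\<close> and \<open>in_set\<close> change under mutation, while
  \<open>verts\<close> does not. Extending both sums by zero terms to \<open>verts Q\<close> makes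
  sums before and after mutation comparable term by term.\<close>

lemma sum_out_set:
  assumes "is_decorated_quiver Q"
  shows "(\<Sum>h \<in> out_set Q m. f h * signed_arrows Q m h) = (\<Sum>h \<in> verts Q. f h * int (arrows Q m h))"
proof -
  have "finite (verts Q)"
    using assms by (auto simp: is_decorated_quiver_def is_quiver_def)
  then show ?thesis
    by (intro sum.mono_neutral_cong_left) (auto simp: out_set_def signed_arrows_def)
qed

lemma sum_in_set:
  assumes "is_decorated_quiver Q"
  shows "(\<Sum>t \<in> in_set Q m. f t * signed_arrows Q t m) = (\<Sum>t \<in> verts Q. f t * int (arrows Q t m))"
proof -
  have "finite (verts Q)"
    using assms by (auto simp: is_decorated_quiver_def is_quiver_def)
  then show ?thesis
    by (intro sum.mono_neutral_cong_left) (auto simp: in_set_def signed_arrows_def)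
qed

lemma balanced_iff_sum_signed_arrows:
  "balanced Q \<longleftrightarrow> is_decorated_quiver Q \<and>
     (\<forall>m \<in> verts Q. (\<Sum>v \<in> verts Q. wt Q v * signed_arrows Q m v) = 0)"
proof (cases "is_decorated_quiver Q")
  case True
  then show ?thesis
    by (simp add: balanced_def sum_out_set sum_in_set)
      (simp add: signed_arrows_eq_diff right_diff_distrib sum_subtractf)
qed (simp add: balanced_def)

lemma diameter_eq_sum_out:
  assumes "balanced Q"
  shows "(\<Sum>h \<in> verts Q. wt Q h * int (arrows Q m h)) = diameter Q m"
  using assms by (simp add: balanced_def diameter_def sum_out_set)

text \<open>Balance at \<open>m\<close> is what makes paths from \<open>x\<close> through
  \<open>m\<close> and paths through \<open>m\<close> to \<open>x\<close> contribute the same factor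
  \<open>diameter Q m\<close>.\<close>

lemma diameter_eq_sum_in:
  assumes "balanced Q" "m \<in> verts Q"
  shows "(\<Sum>t \<in> verts Q. wt Q t * int (arrows Q t m)) = diameter Q m"
  using assms by (simp add: balanced_def diameter_def sum_in_set)

lemma verts_mut [simp]: "verts (mut m Q) = verts Q"
  by (simp add: mut_def quiver_mutation_def)

lemma arrows_mut:
  "arrows (mut m Q) = cancel_2_cycles (reverse_at m (add_composites m (arrows Q)))"
  by (simp add: mut_def quiver_mutation_def)

lemma wt_mut: "wt (mut m Q) v = (if v = m then diameter Q m - wt Q m else wt Q v)"
  by (simp add: mut_def wt_def)

text \<open>Both directions lose the same minimum, and the truncated subtraction is exact because
  the minimum exceeds neither number.\<close>

lemma cancel_2_cycles_diff:
  "int (cancel_2_cycles a x y) - int (cancel_2_cycles a y x) = int (a x y) - int (a y x)"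
  by (auto simp: cancel_2_cycles_def min_def)

lemma is_decorated_quiver_mut:
  assumes "is_decorated_quiver Q"
  shows "is_decorated_quiver (mut m Q)"
proof -
  let ?b = "reverse_at m (add_composites m (arrows Q))"
  have fin: "finite (verts Q)"
    using assms by (simp add: is_decorated_quiver_def is_quiver_def)
  have supp: "x \<in> verts Q \<and> y \<in> verts Q" if "arrows Q x y > 0" for x y
    using assms that by (auto simp: is_decorated_quiver_def is_quiver_def)
  have loop: "arrows Q x x = 0" and cyc: "arrows Q x y = 0 \<or> arrows Q y x = 0" for x y
    using assms by (auto simp: is_decorated_quiver_def)
  have "x \<in> verts Q \<and> y \<in> verts Q" if "?b x y > 0" for x y
    using that supp by (auto simp: reverse_at_def add_composites_def split: if_splits)
  moreover have "?b x y > 0" if "cancel_2_cycles ?b x y > 0" for x y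
    using that by (simp add: cancel_2_cycles_def split: if_splits)
  \<comment> \<open>For \<open>x\<close> other than \<open>m\<close>, a composite loop would need a
    2-cycle between \<open>x\<close> and \<open>m\<close>.\<close>
  moreover have "?b x x = 0" for x
    using cyc[of x m] by (auto simp: reverse_at_def add_composites_def loop)
  then have "cancel_2_cycles ?b x x = 0" for x
    by (simp add: cancel_2_cycles_def)
  moreover from this have "\<not> (cancel_2_cycles ?b x y > 0 \<and> cancel_2_cycles ?b y x > 0)" for x y
    by (cases "x = y") (simp_all add: cancel_2_cycles_def)
  ultimately show ?thesis
    using fin unfolding is_decorated_quiver_def is_quiver_def arrows_mut verts_mut
    by blast
qed

text \<open>Composites starting or ending at \<open>m\<close> carry the factor
  \<open>arrows Q m m = 0\<close>, so row and column \<open>m\<close> are merely reversed.\<close>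

lemma signed_arrows_mut:
  assumes "is_decorated_quiver Q"
  shows "signed_arrows (mut m Q) x y =
    (if x = m \<or> y = m then - signed_arrows Q x y
     else signed_arrows Q x y + int (arrows Q x m) * int (arrows Q m y)
       - int (arrows Q y m) * int (arrows Q m x))"
proof -
  have loop: "arrows Q m m = 0"
    using assms by (simp add: is_decorated_quiver_def)
  show ?thesis
    unfolding signed_arrows_eq_diff[OF assms]
      signed_arrows_eq_diff[OF is_decorated_quiver_mut[OF assms]]
      arrows_mut cancel_2_cycles_diff reverse_at_def add_composites_def
    by (simp add: loop)
qed

lemma balanced_mut:
  assumes "balanced Q" "m \<in> verts Q"
  shows "balanced (mut m Q)"
  unfolding balanced_iff_sum_signed_arrows verts_mut
proof (intro conjI ballI)
  have dec: "is_decorated_quiver Q"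
    using assms by (simp add: balanced_def)
  then show "is_decorated_quiver (mut m Q)"
    by (rule is_decorated_quiver_mut)
  have fin: "finite (verts Q)" and loop: "arrows Q m m = 0"
    using dec by (auto simp: is_decorated_quiver_def is_quiver_def)
  fix x assume x: "x \<in> verts Q"
  let ?a = "\<lambda>x y. int (arrows Q x y)" and ?s = "signed_arrows Q"
  let ?D = "diameter Q m"
  have bal: "(\<Sum>v \<in> verts Q. wt Q v * ?s x v) = 0"
    using assms(1) x by (simp add: balanced_iff_sum_signed_arrows)
  show "(\<Sum>v \<in> verts Q. wt (mut m Q) v * signed_arrows (mut m Q) x v) = 0"
  proof (cases "x = m")
    case True
    \<comment> \<open>This entry hides the changed weight of \<open>m\<close> from the sum at
      \<open>m\<close>.\<close>
    have "?s m m = 0"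
      using loop by (simp add: signed_arrows_def)
    then have "(\<Sum>v \<in> verts Q. wt (mut m Q) v * signed_arrows (mut m Q) x v)
        = (\<Sum>v \<in> verts Q. - (wt Q v * ?s x v))"
      by (intro sum.cong) (auto simp: True wt_mut signed_arrows_mut[OF dec])
    then show ?thesis
      using bal by (simp add: sum_negf)
  next
    case False
    \<comment> \<open>One formula covers all \<open>v\<close>: at \<open>v = m\<close> the composite
      terms vanish, and \<open>(?D - wt Q m) * (- ?s x m)\<close> is the old term minus
      \<open>?D * ?s x m\<close>.\<close>
    have "(\<Sum>v \<in> verts Q. wt (mut m Q) v * signed_arrows (mut m Q) x v)
        = (\<Sum>v \<in> verts Q. wt Q v * ?s x v + ?a x m * (wt Q v * ?a m v)
            - ?a m x * (wt Q v * ?a v m) - (if v = m then ?D * ?s x m else 0))"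
    proof (rule sum.cong[OF refl])
      fix v
      show "wt (mut m Q) v * signed_arrows (mut m Q) x v
          = wt Q v * ?s x v + ?a x m * (wt Q v * ?a m v) - ?a m x * (wt Q v * ?a v m)
            - (if v = m then ?D * ?s x m else 0)"
        using False loop
        by (cases "v = m") (simp_all add: wt_mut signed_arrows_mut[OF dec] algebra_simps)
    qed
    also have "\<dots> = ?a x m * ?D - ?a m x * ?D - ?D * ?s x m"
      unfolding sum.distrib sum_subtractf bal sum_distrib_left[symmetric]
        diameter_eq_sum_out[OF assms(1)] diameter_eq_sum_in[OF assms]
      using fin assms(2) by simp
    also have "\<dots> = 0"
      by (simp add: signed_arrows_eq_diff[OF dec] algebra_simps)
    finally show ?thesis .
  qed
qed

lemma balanced_fold_mut:
  assumes "balanced Q" "set ms \<subseteq> verts Q"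
  shows "balanced (fold mut ms Q)"
  using assms by (induction ms arbitrary: Q) (auto simp: balanced_mut)

theorem proposition4p4:
  fixes Q :: "'v decorated_quiver"
  assumes "balanced Q"
  shows "(\<forall>m \<in> verts Q. balanced (mut m Q)) \<and>
         (\<forall>ms. set ms \<subseteq> verts Q \<longrightarrow> balanced (fold mut ms Q))"
  by (simp add: assms balanced_mut balanced_fold_mut)

end
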